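(* Let $q$ be a prime power, $\mathbb{F}$ an extension field of $\mathbb{F}_q$, $1\le k\le n$, $\ell\ge1$. Let $C$ be an $[n,k]_{\mathbb{F}}$ code that is $\mathrm{GKP}(\ell)$, with generator matrix $G\in\mathbb{F}^{k\times n}$. Let $V_1,\dots,V_\ell$ be $\mathbb{F}_q$-subspaces of $\mathbb{F}_q^n$, each of dimension at most $k$. Then \[ \dim_{\mathbb{F}}\Big(\bigcap_{i\in[\ell]}G_{V_i}\Big)=\max_{P_1\sqcup\cdots\sqcup P_s=[\ell]}\Big(\sum_{i\in[s]}\dim_{\mathbb{F}_q}\Big(\bigcap_{j\in P_i}V_j\Big)-(s-1)k\Big), \] the maximum being over all partitions of $[\ell]$ into nonempty parts.
   Context: An $[n,k]_{\mathbb{F}}$ code is a $k$-dimensional subspace $C\subseteq\mathbb{F}^n$; $G$ is a generator matrix if $C=\{G^T\bm{u}\}$. For an $\mathbb{F}_q$-subspace $V\subseteq\mathbb{F}_q^n$, $G_V\subseteq\mathbb{F}^k$ is the $\mathbb{F}$-column span of $GA$ for any $A\in\mathbb{F}_q^{n\times\dim V}$ with $\mathbb{F}_q$-column span $V$. $C$ is MRD if every nonzero codeword $\bm{v}$ satisfies $\dim_{\mathbb{F}_q}\mathrm{span}_{\mathbb{F}_q}\{v_1,\dots,v_n\}\ge n-k+1$. A kernel pattern $(V_1,\dots,V_k)$ (subspaces of $\mathbb{F}_q^n$) is generic if $\dim(\bigcap_{i\in\Omega}V_i)\le k-|\Omega|$ for all nonempty $\Omega\subseteq[k]$, and has order $\ell$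 if exactly $\ell$ distinct nonzero subspaces occur among them; $C$ attains it if for full-rank $A_i$ with column span $V_i$ there is an invertible $M$ with rows $\bm{m}_i$ and $\bm{m}_iGA_i=0$ for all $i$. $C$ is $\mathrm{GKP}(\ell)$ if it is MRD and attains all generic kernel patterns of order at most $\ell$. *)

theory Defs
  imports "HOL-Analysis.Analysis" "HOL-Library.Disjoint_Sets"
begin

text \<open>The base field F_q is a finite field type 'k, the extension field F is a field type 'a,
  and the extension is given by a field homomorphism phi : 'k => 'a (necessarily injective).
  n = CARD('n), k = CARD('kk); a generator matrix is G :: 'a^'n^'kk (k rows, n columns).\<close>

definition field_hom :: "('k::field \<Rightarrow> 'a::field) \<Rightarrow> bool" where
  "field_hom \<phi> \<longleftrightarrow> \<phi> 1 = 1 \<and> (\<forall>x y. \<phi> (x + y) = \<phi> x + \<phi> y) \<and> (\<forall>x y. \<phi> (x * y) = \<phi> x * \<phi> y)"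

definition vmap :: "('k \<Rightarrow> 'a) \<Rightarrow> 'k^'n \<Rightarrow> 'a^'n" where
  "vmap \<phi> v = (\<chi> j. \<phi> (v $ j))"

text \<open>G_V: the F-column span of G A, where the F_q-columns of A span V; equivalently the
  F-span of the vectors G v, v in V.\<close>
definition GV :: "'a::field^'n^'kk \<Rightarrow> ('k::field \<Rightarrow> 'a) \<Rightarrow> ('k^'n) set \<Rightarrow> ('a^'kk) set" where
  "GV G \<phi> V = vec.span ((\<lambda>v. G *v vmap \<phi> v) ` V)"

text \<open>MRD: every nonzero codeword G^T u has entries spanning an F_q-space of dimension >= n-k+1
  (F viewed as F_q-vector space via scalar multiplication c . x = phi c * x).\<close>
definition MRD :: "('k::field \<Rightarrow> 'a::field) \<Rightarrow> 'a^'n^'kk \<Rightarrow> bool" where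
  "MRD \<phi> G \<longleftrightarrow> (\<forall>u::'a^'kk. transpose G *v u \<noteq> 0 \<longrightarrow>
      vector_space.dim (\<lambda>c x. \<phi> c * x) (range (\<lambda>j. (transpose G *v u) $ j))
        \<ge> CARD('n) - CARD('kk) + 1)"

definition kernel_pattern :: "('kk \<Rightarrow> ('k::field^'n) set) \<Rightarrow> bool" where
  "kernel_pattern V \<longleftrightarrow> (\<forall>i. vec.subspace (V i))"

definition generic_kp :: "('kk::finite \<Rightarrow> ('k::field^'n) set) \<Rightarrow> bool" where
  "generic_kp V \<longleftrightarrow> (\<forall>\<Omega>. \<Omega> \<noteq> {} \<longrightarrow>
      int (vec.dim (\<Inter>i\<in>\<Omega>. V i)) \<le> int CARD('kk) - int (card \<Omega>))"

text \<open>order: number of distinct nonzero subspaces among V_1..V_k\<close>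
definition kp_order :: "('kk \<Rightarrow> ('k::field^'n) set) \<Rightarrow> nat" where
  "kp_order V = card (range V - {{0}})"

text \<open>Attaining: there is an invertible M with rows m_i such that m_i G A_i = 0, i.e.
  m_i G v = 0 for all v in the column span V_i of A_i.\<close>
definition attains :: "('k::field \<Rightarrow> 'a::field) \<Rightarrow> 'a^'n^'kk \<Rightarrow> ('kk \<Rightarrow> ('k^'n) set) \<Rightarrow> bool" where
  "attains \<phi> G V \<longleftrightarrow> (\<exists>M::'a^'kk^'kk. invertible M \<and>
      (\<forall>i. \<forall>v\<in>V i. ((M ** G) *v vmap \<phi> v) $ i = 0))"

definition GKP :: "('k::field \<Rightarrow> 'a::field) \<Rightarrow> 'a^'n^'kk \<Rightarrow> nat \<Rightarrow> bool" where
  "GKP \<phi> G l \<longleftrightarrow> MRD \<phi> G \<and>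
     (\<forall>V :: 'kk \<Rightarrow> ('k^'n) set. kernel_pattern V \<and> generic_kp V \<and> kp_order V \<le> l \<longrightarrow> attains \<phi> G V)"

end

theory Submission
  imports Defs
begin

text \<open>For every partition \<open>P\<close> of \<open>[\<ell>]\<close> the right-hand side is a lower bound: by the MRD
  property, \<open>G\<close> maps an \<open>F\<^sub>q\<close>-subspace \<open>U\<close> of dimension at most \<open>k\<close> to an \<open>F\<close>-space
  \<open>G\<^sub>U\<close> of dimension at least \<open>dim U\<close> (the image of a basis of \<open>U\<close>, extended to \<open>k\<close>
  vectors, is a basis of \<open>F\<^sup>k\<close>), and an intersection of \<open>|P|\<close> subspaces of \<open>F\<^sup>k\<close> has
  codimension at most the sum of their codimensions.

  For the upper bound, \<open>f(S) = k - dim (\<Inter>\<^sub>j\<^sub>\<in>\<^sub>S V\<^sub>j)\<close> is submodular on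
  intersecting sets, so by Edmonds' theorem a maximal vector \<open>a\<close> with \<open>a(S) \<le> f(S)\<close> for all
  \<open>S\<close> has \<open>a([\<ell>]) = \<Sum>\<^sub>B\<^sub>\<in>\<^sub>P f(B)\<close> for some partition \<open>P\<close>. Giving \<open>a\<^sub>i\<close> of the
  \<open>k\<close> rows the kernel \<open>V\<^sub>i\<close> and the remaining rows the kernel \<open>{0}\<close> yields a generic
  kernel pattern of order at most \<open>\<ell>\<close>; the invertible matrix attaining it has \<open>a([\<ell>])\<close>
  rows vanishing on \<open>\<Inter>\<^sub>i GV(V\<^sub>i)\<close>, so this intersection has dimension at most
  \<open>k - a([\<ell>])\<close>.\<close>

section \<open>Polymatroids of intersecting submodular functions\<close>

definition in_polymatroid :: "'b set \<Rightarrow> ('b set \<Rightarrow> nat) \<Rightarrow> ('b \<Rightarrow> nat) \<Rightarrow> bool" where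
  "in_polymatroid L f a \<longleftrightarrow> (\<forall>S\<subseteq>L. S \<noteq> {} \<longrightarrow> sum a S \<le> f S)"

lemma ex_max_in_polymatroid:
  "\<exists>a. in_polymatroid L f a \<and> (\<forall>b. in_polymatroid L f b \<longrightarrow> sum b L \<le> sum a L)"
proof (rule ex_has_greatest_nat)
  show "in_polymatroid L f (\<lambda>_. 0)"
    by (simp add: in_polymatroid_def)
  show "\<forall>a. in_polymatroid L f a \<longrightarrow> sum a L < f L + 1"
  proof (intro allI impI)
    fix a assume a: "in_polymatroid L f a"
    show "sum a L < f L + 1"
    proof (cases "L = {}")
      case False
      then show ?thesis
        using a unfolding in_polymatroid_def by fastforce
    qed simp
  qed
qed

text \<open>Otherwise the coordinate \<open>i\<close> of the maximal vector could be raised by one.\<close>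
lemma max_in_polymatroid_tight:
  assumes "finite L" and a: "in_polymatroid L f a"
    and maximal: "\<forall>b. in_polymatroid L f b \<longrightarrow> sum b L \<le> sum a L" and "i \<in> L"
  shows "\<exists>S\<subseteq>L. i \<in> S \<and> sum a S = f S"
proof (rule ccontr)
  assume not_tight: "\<not> ?thesis"
  define b where "b j = a j + (if j = i then 1 else 0)" for j
  have sum_b: "sum b S = sum a S + (if i \<in> S then 1 else 0)" if "finite S" for S
    using that by (simp add: b_def sum.distrib)
  have "in_polymatroid L f b"
    unfolding in_polymatroid_def
  proof (intro allI impI)
    fix S assume S: "S \<subseteq> L" "S \<noteq> {}"
    then have "sum a S \<le> f S" "finite S"
      using a \<open>finite L\<close> by (auto simp: in_polymatroid_def intro: finite_subset)
    moreover have "sum a S \<noteq> f S" if "i \<in> S"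
      using not_tight S that by blast
    ultimately show "sum b S \<le> f S"
      using sum_b by (cases "i \<in> S") auto
  qed
  then have "sum b L \<le> sum a L"
    using maximal by blast
  then show False
    using sum_b[OF \<open>finite L\<close>] \<open>i \<in> L\<close> by simp
qed

lemma tight_Union:
  assumes "finite L" and a: "in_polymatroid L f a"
    and submod: "\<And>S T. S \<subseteq> L \<Longrightarrow> T \<subseteq> L \<Longrightarrow> S \<inter> T \<noteq> {} \<Longrightarrow> f (S \<union> T) + f (S \<inter> T) \<le> f S + f T"
    and "finite F" "F \<noteq> {}" "\<forall>S\<in>F. S \<subseteq> L \<and> i \<in> S \<and> sum a S = f S"
  shows "sum a (\<Union>F) = f (\<Union>F)"
  using assms(4-6)
proof (induction F rule: finite_ne_induct)
  case (singleton S)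
  then show ?case by simp
next
  case (insert S F)
  define T where "T = \<Union>F"
  have S: "S \<subseteq> L" "i \<in> S" "sum a S = f S" and T: "T \<subseteq> L" "i \<in> T" "sum a T = f T"
    using insert by (auto simp: T_def)
  have fin: "finite S" "finite T"
    using S(1) T(1) \<open>finite L\<close> by (auto intro: finite_subset)
  have bound: "sum a U \<le> f U" if "U \<subseteq> L" "U \<noteq> {}" for U
    using a that by (simp add: in_polymatroid_def)
  have "sum a (S \<union> T) \<le> f (S \<union> T)" "sum a (S \<inter> T) \<le> f (S \<inter> T)"
    using S T by (auto intro!: bound)
  moreover have "sum a (S \<union> T) + sum a (S \<inter> T) = sum a S + sum a T"
    using fin by (rule sum.union_inter)
  moreover have "f (S \<union> T) + f (S \<inter> T) \<le> f S + f T"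
    using S T by (intro submod) auto
  ultimately show ?case
    using S(3) T(3) by (simp add: T_def)
qed

text \<open>One half of Edmonds' min-max theorem for intersecting submodular functions; the blocks
  are the maximal tight sets.\<close>
lemma in_polymatroid_tight_partition:
  assumes "finite L"
    and submod: "\<And>S T. S \<subseteq> L \<Longrightarrow> T \<subseteq> L \<Longrightarrow> S \<inter> T \<noteq> {} \<Longrightarrow> f (S \<union> T) + f (S \<inter> T) \<le> f S + f T"
  shows "\<exists>a P. in_polymatroid L f a \<and> partition_on L P \<and> sum a L = (\<Sum>B\<in>P. f B)"
proof -
  obtain a where a: "in_polymatroid L f a"
    and maximal: "\<forall>b. in_polymatroid L f b \<longrightarrow> sum b L \<le> sum a L"
    using ex_max_in_polymatroid by blast
  define tight where "tight i = {S. S \<subseteq> L \<and> i \<in> S \<and> sum a S = f S}" for i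
  define T where "T i = \<Union>(tight i)" for i
  have T: "T i \<subseteq> L" "i \<in> T i" "sum a (T i) = f (T i)" if "i \<in> L" for i
  proof -
    have "tight i \<subseteq> Pow L"
      by (auto simp: tight_def)
    then have "finite (tight i)"
      by (rule finite_subset) (simp add: \<open>finite L\<close>)
    moreover have "tight i \<noteq> {}"
      using max_in_polymatroid_tight[OF \<open>finite L\<close> a maximal that] by (auto simp: tight_def)
    ultimately show "T i \<subseteq> L" "i \<in> T i" "sum a (T i) = f (T i)"
      unfolding T_def using tight_Union[OF \<open>finite L\<close> a submod] by (auto simp: tight_def)
  qed
  have T_eq: "T i = T j" if ij: "i \<in> L" "j \<in> L" and "T i \<inter> T j \<noteq> {}" for i j
  proof -
    obtain x where "x \<in> T i" "x \<in> T j"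
      using \<open>T i \<inter> T j \<noteq> {}\<close> by blast
    have "sum a (\<Union>{T i, T j}) = f (\<Union>{T i, T j})"
      using T ij \<open>x \<in> T i\<close> \<open>x \<in> T j\<close> by (intro tight_Union[OF \<open>finite L\<close> a submod]) auto
    then have "T i \<union> T j \<in> tight i \<inter> tight j"
      using T ij by (auto simp: tight_def)
    then show ?thesis
      unfolding T_def by blast
  qed
  define P where "P = T ` L"
  have P: "partition_on L P"
  proof (rule partition_onI)
    show "\<Union>P = L"
      using T by (auto simp: P_def)
    show "disjnt B B'" if "B \<in> P" "B' \<in> P" "B \<noteq> B'" for B B'
      using that T_eq by (auto simp: P_def disjnt_def)
    show "{} \<notin> P"
      using T(2) by (force simp: P_def)
  qed
  have "sum a L = (\<Sum>B\<in>P. sum a B)"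
    using \<open>finite L\<close> P by (rule sum.partition)
  also have "\<dots> = (\<Sum>B\<in>P. f B)"
    using T by (auto simp: P_def intro: sum.cong)
  finally show ?thesis
    using a P by blast
qed

text \<open>Slots \<open>r\<close> are assigned injectively to the pairs \<open>(i, t)\<close> with \<open>t < a i\<close>.\<close>
lemma ex_slot_assignment:
  fixes a :: "'b \<Rightarrow> nat"
  assumes "finite L" "sum a L \<le> CARD('r::finite)"
  shows "\<exists>g :: 'r \<Rightarrow> 'b option. (\<forall>r i. g r = Some i \<longrightarrow> i \<in> L)
    \<and> (\<forall>i\<in>L. card {r. g r = Some i} = a i) \<and> card {r. g r \<noteq> None} = sum a L"
proof -
  define X where "X = Sigma L (\<lambda>i. {..<a i})"
  have "finite X" "card X = sum a L"
    using \<open>finite L\<close> by (simp_all add: X_def)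
  then obtain e :: "'b \<times> nat \<Rightarrow> 'r" where e: "inj_on e X"
    using card_le_inj[of X "UNIV :: 'r set"] assms(2) by auto
  define g where "g r = (if r \<in> e ` X then Some (fst (the_inv_into X e r)) else None)" for r
  have g_e: "g (e x) = Some (fst x)" if "x \<in> X" for x
    using that e by (simp add: g_def the_inv_into_f_f)
  have preimage: "\<exists>x\<in>X. r = e x \<and> fst x = i" if "g r = Some i" for r i
  proof -
    obtain x where "x \<in> X" "r = e x"
      using \<open>g r = Some i\<close> by (auto simp: g_def split: if_splits)
    then show ?thesis
      using g_e \<open>g r = Some i\<close> by auto
  qed
  have "{r. g r = Some i} = e ` ({i} \<times> {..<a i})" if "i \<in> L" for i
  proof
    show "{r. g r = Some i} \<subseteq> e ` ({i} \<times> {..<a i})"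
      using preimage by (fastforce simp: X_def)
    show "e ` ({i} \<times> {..<a i}) \<subseteq> {r. g r = Some i}"
      using that g_e by (auto simp: X_def)
  qed
  moreover have "card (e ` ({i} \<times> {..<a i})) = a i" if "i \<in> L" for i
    using that by (subst card_image[OF inj_on_subset[OF e]]) (auto simp: X_def)
  moreover have "g r = Some i \<Longrightarrow> i \<in> L" for r i
    using preimage by (fastforce simp: X_def)
  moreover have "{r. g r \<noteq> None} = e ` X"
    by (auto simp: g_def)
  ultimately show ?thesis
    using card_image[OF e] \<open>card X = sum a L\<close> by (intro exI[of _ g]) auto
qed

section \<open>Linear algebra in \<open>F\<^sup>n\<close>\<close>

lemma dim_add_dim_le:
  fixes A B C :: "('a::field^'n) set"
  assumes "vec.subspace A" "vec.subspace B" "{x + y | x y. x \<in> A \<and> y \<in> B} \<subseteq> C"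
  shows "vec.dim A + vec.dim B \<le> vec.dim (A \<inter> B) + vec.dim C"
  using vec.dim_sums_Int[OF assms(1,2)] vec.dim_subset[OF assms(3)] by linarith

lemma dim_Inter_supermodular:
  fixes V :: "'b \<Rightarrow> ('a::field^'n) set"
  assumes "\<forall>j\<in>S \<union> T. vec.subspace (V j)"
  shows "vec.dim (\<Inter>j\<in>S. V j) + vec.dim (\<Inter>j\<in>T. V j)
    \<le> vec.dim (\<Inter>j\<in>S \<union> T. V j) + vec.dim (\<Inter>j\<in>S \<inter> T. V j)"
proof -
  have "{x + y |x y. x \<in> (\<Inter>j\<in>S. V j) \<and> y \<in> (\<Inter>j\<in>T. V j)} \<subseteq> (\<Inter>j\<in>S \<inter> T. V j)"
    using assms by (auto intro: vec.subspace_add)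
  then show ?thesis
    using assms by (subst INT_Un) (intro dim_add_dim_le vec.subspace_Inter; auto)
qed

lemma dim_Inter_le:
  fixes V :: "'b \<Rightarrow> ('a::field^'n) set"
  assumes "S \<subseteq> L" "S \<noteq> {}" "\<forall>i\<in>L. vec.dim (V i) \<le> d"
  shows "vec.dim (\<Inter>j\<in>S. V j) \<le> d"
proof -
  obtain j where "j \<in> S"
    using assms(2) by blast
  then have "vec.dim (\<Inter>j\<in>S. V j) \<le> vec.dim (V j)"
    by (intro vec.dim_subset) blast
  also have "\<dots> \<le> d"
    using assms(1,3) \<open>j \<in> S\<close> by blast
  finally show ?thesis .
qed

lemma extend_to_basis_cart:
  fixes S :: "('a::field^'n) set"
  assumes "vec.independent S"
  obtains B where "S \<subseteq> B" "vec.independent B" "finite B" "vec.span B = UNIV" "card B = CARD('n)"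
proof -
  obtain B where B: "S \<subseteq> B" "B \<subseteq> UNIV" "vec.independent B" "UNIV \<subseteq> vec.span B"
    by (rule vec.maximal_independent_subset_extend[OF subset_UNIV assms])
  then have "vec.span B = UNIV"
    by blast
  moreover have "finite B"
    using B(3) by (rule vec.finiteI_independent)
  moreover have "card B = CARD('n)"
    using vec.dim_span_eq_card_independent[OF B(3)] \<open>vec.span B = UNIV\<close>
    by (simp add: card_cart_basis)
  ultimately show ?thesis
    using B that by blast
qed

lemma dim_Inter_ge:
  fixes X :: "'b \<Rightarrow> ('a::field^'n) set"
  assumes "finite P" "\<forall>B\<in>P. vec.subspace (X B)"
  shows "(\<Sum>B\<in>P. int (vec.dim (X B))) - (int (card P) - 1) * int CARD('n)
    \<le> int (vec.dim (\<Inter>B\<in>P. X B))"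
  using assms
proof (induction P rule: finite_induct)
  case empty
  then show ?case
    by (simp add: card_cart_basis)
next
  case (insert B P)
  have "vec.dim (X B) + vec.dim (\<Inter>B\<in>P. X B)
      \<le> vec.dim (X B \<inter> (\<Inter>B\<in>P. X B)) + vec.dim (UNIV :: ('a^'n) set)"
    using insert.prems by (intro dim_add_dim_le vec.subspace_Inter) auto
  then show ?case
    using insert by (simp add: card_cart_basis algebra_simps)
qed

lemma dim_le_if_rows_vanish:
  fixes M :: "'a::field^'m^'m"
  assumes "invertible M" "\<forall>y\<in>Z. \<forall>r\<in>R. (M *v y)$r = 0"
  shows "vec.dim Z \<le> CARD('m) - card R"
proof -
  have "inj ((*v) M)"
    using assms(1) by (simp add: invertible_left_inverse matrix_left_invertible_injective)
  then have "inj_on ((*v) M) (vec.span Z)"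
    by (rule inj_on_subset) simp
  then have "vec.dim Z = vec.dim ((*v) M ` Z)"
    by (rule vec.dim_image_eq[OF matrix_vector_mul_linear_gen, symmetric])
  also have "\<dots> \<le> vec.dim {x::'a^'m. \<forall>i. i \<notin> - R \<longrightarrow> x$i = 0}"
    using assms(2) by (intro vec.dim_subset) auto
  also have "\<dots> = CARD('m) - card R"
    by (subst dim_substandard_cart) (simp add: Compl_eq_Diff_UNIV card_Diff_subset)
  finally show ?thesis .
qed

lemma sum_matrix_vector_mult_transpose:
  fixes A :: "'a::comm_semiring_1^'n^'m"
  shows "(\<Sum>i\<in>UNIV. (A *v x)$i * y$i) = (\<Sum>j\<in>UNIV. x$j * (transpose A *v y)$j)"
proof -
  have "(\<Sum>i\<in>UNIV. (A *v x)$i * y$i) = (\<Sum>i\<in>UNIV. \<Sum>j\<in>UNIV. A$i$j * x$j * y$i)"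
    by (simp add: matrix_vector_mult_def sum_distrib_right)
  also have "\<dots> = (\<Sum>j\<in>UNIV. \<Sum>i\<in>UNIV. A$i$j * x$j * y$i)"
    by (rule sum.swap)
  also have "\<dots> = (\<Sum>j\<in>UNIV. x$j * (transpose A *v y)$j)"
    by (simp add: matrix_vector_mult_def transpose_def sum_distrib_left mult_ac)
  finally show ?thesis .
qed

lemma inj_transpose_if_full_row_rank:
  fixes G :: "'a::field^'n^'m"
  assumes "rank G = CARD('m)"
  shows "inj ((*v) (transpose G))"
proof -
  have col: "transpose G *v axis i 1 = row i G" for i
  proof -
    have "(\<Sum>m\<in>UNIV. G$m$j * (if m = i then 1 else 0)) = G$i$j" for j
      by (simp add: if_distrib[of "(*) _"] cong: if_cong)
    then show ?thesis
      by (simp add: vec_eq_iff row_def matrix_vector_mult_def transpose_def axis_def)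
  qed
  have "(*v) (transpose G) ` cart_basis = range (\<lambda>i. transpose G *v axis i 1)"
    unfolding cart_basis_def by blast
  also have "\<dots> = rows G"
    unfolding col by (simp add: rows_def full_SetCompr_eq)
  finally have row_image: "(*v) (transpose G) ` cart_basis = rows G" .
  have rows_range: "rows G = range (\<lambda>i. row i G)"
    by (auto simp: rows_def)
  have "vec.dim (rows G) \<le> card (rows G)"
    by (rule vec.dim_le_card[OF vec.span_superset]) (simp add: rows_range)
  moreover have "card (rows G) \<le> CARD('m)"
    unfolding rows_range by (rule card_image_le) simp
  moreover have dim_rows: "vec.dim (rows G) = CARD('m)"
    using assms by (simp add: row_rank_def_gen)
  ultimately have card_rows: "card (rows G) = card (cart_basis :: ('a^'m) set)"
    by (simp add: card_cart_basis)
  have "vec.independent (rows G)"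
    by (rule vec.card_le_dim_spanning[OF subset_refl vec.span_superset])
      (simp add: rows_range, simp add: card_rows dim_rows card_cart_basis)
  then have "vec.independent ((*v) (transpose G) ` cart_basis)"
    unfolding row_image .
  then have "inj_on ((*v) (transpose G)) (vec.span cart_basis)
      \<longleftrightarrow> inj_on ((*v) (transpose G)) cart_basis"
    by (rule vec.linear_inj_on_span_iff_independent_image[OF matrix_vector_mul_linear_gen])
  moreover have "inj_on ((*v) (transpose G)) cart_basis"
    by (rule eq_card_imp_inj_on[OF finite_cart_basis]) (simp only: row_image card_rows)
  ultimately have "inj_on ((*v) (transpose G)) (vec.span cart_basis)"
    by blast
  then show ?thesis
    by (simp add: vec.span_Basis)
qed

section \<open>MRD codes\<close>

lemma field_hom_simps:
  assumes "field_hom \<phi>"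
  shows "\<phi> 0 = 0" "\<phi> 1 = 1" "\<phi> (x + y) = \<phi> x + \<phi> y" "\<phi> (x * y) = \<phi> x * \<phi> y"
proof -
  show "\<phi> 1 = 1" "\<phi> (x + y) = \<phi> x + \<phi> y" "\<phi> (x * y) = \<phi> x * \<phi> y"
    using assms by (auto simp: field_hom_def)
  have "\<phi> (0 + 0) = \<phi> 0 + \<phi> 0" using assms unfolding field_hom_def by blast
  then show "\<phi> 0 = 0"
    by (metis add_0 add_cancel_right_right)
qed

lemma vector_space_field_hom:
  assumes "field_hom (\<phi> :: 'k::field \<Rightarrow> 'a::field)"
  shows "vector_space (\<lambda>a (x::'a). \<phi> a * x)"
  by unfold_locales (simp_all add: field_hom_simps[OF assms] algebra_simps)

lemma linear_field_hom_pairing: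
  fixes \<phi> :: "'k::field \<Rightarrow> 'a::field" and c :: "'a^'n"
  assumes "field_hom \<phi>"
  shows "Vector_Spaces.linear (*s) (\<lambda>a x. \<phi> a * x) (\<lambda>s. \<Sum>m\<in>UNIV. \<phi> (s$m) * c$m)"
  unfolding Vector_Spaces.linear_iff
  by (simp add: vector_space_field_hom[OF assms] vec.vector_space_axioms field_hom_simps[OF assms]
      sum.distrib sum_distrib_left distrib_right mult.assoc)

text \<open>The entries of \<open>c\<close> are the values on the unit vectors of an \<open>F\<^sub>q\<close>-linear functional
  vanishing on \<open>S\<close>.\<close>
lemma dim_entries_le_if_annihilated:
  fixes \<phi> :: "'k::field \<Rightarrow> 'a::field" and c :: "'a^'n" and S :: "('k^'n) set"
  assumes hom: "field_hom \<phi>" and ind: "vec.independent S"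
    and ann: "\<forall>s\<in>S. (\<Sum>m\<in>UNIV. \<phi> (s$m) * c$m) = 0"
  shows "vector_space.dim (\<lambda>a x. \<phi> a * x) (range (\<lambda>j. c$j)) \<le> CARD('n) - card S"
proof -
  define f where "f s = (\<Sum>m\<in>UNIV. \<phi> (s$m) * c$m)" for s :: "'k^'n"
  interpret f: Vector_Spaces.linear "(*s)" "\<lambda>a x. \<phi> a * x" f
    unfolding f_def by (rule linear_field_hom_pairing[OF hom])
  obtain B where B: "S \<subseteq> B" "finite B" "vec.span B = UNIV" "card B = CARD('n)"
    by (rule extend_to_basis_cart[OF ind])
  have f_axis: "f (axis j 1) = c$j" for j
  proof -
    have "f (axis j 1) = (\<Sum>m\<in>UNIV. if m = j then c$m else 0)"
      unfolding f_def by (rule sum.cong) (auto simp: axis_def field_hom_simps[OF hom])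
    then show ?thesis by simp
  qed
  have "range (\<lambda>j. c$j) \<subseteq> f ` vec.span B"
    unfolding B(3) by (auto simp flip: f_axis)
  also have "f ` vec.span B = f.vs2.span (f ` B)"
    by (simp add: f.span_image)
  also have "\<dots> \<subseteq> f.vs2.span (insert 0 (f ` (B - S)))"
    using ann by (intro f.vs2.span_mono) (auto simp: f_def)
  finally have "f.vs2.dim (range (\<lambda>j. c$j)) \<le> card (f ` (B - S))"
    by (intro f.vs2.dim_le_card) (use B(2) in auto)
  also have "\<dots> \<le> card (B - S)"
    using B(2) by (intro card_image_le) simp
  also have "\<dots> = CARD('n) - card S"
    using B(1,2,4) by (simp add: card_Diff_subset finite_subset)
  finally show ?thesis .
qed

lemma MRD_annihilator_eq_0:
  fixes \<phi> :: "'k::field \<Rightarrow> 'a::field" and G :: "'a^'n^'kk" and S :: "('k^'n) set"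
  assumes hom: "field_hom \<phi>" and mrd: "MRD \<phi> G" and rank: "rank G = CARD('kk)"
    and ind: "vec.independent S" and card: "CARD('kk) \<le> card S"
    and ann: "\<forall>s\<in>S. (\<Sum>i\<in>UNIV. (G *v vmap \<phi> s)$i * u$i) = 0"
  shows "u = 0"
proof (rule ccontr)
  assume "u \<noteq> 0"
  define c where "c = transpose G *v u"
  have "c \<noteq> 0"
    using inj_transpose_if_full_row_rank[OF rank] \<open>u \<noteq> 0\<close>
    unfolding c_def by (metis injD matrix_vector_mult_0_right)
  then have "CARD('n) - CARD('kk) + 1 \<le> vector_space.dim (\<lambda>a x. \<phi> a * x) (range (\<lambda>j. c$j))"
    using mrd unfolding MRD_def c_def by blast
  also have "\<dots> \<le> CARD('n) - card S"
  proof (rule dim_entries_le_if_annihilated[OF hom ind], intro ballI)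
    fix s assume "s \<in> S"
    then show "(\<Sum>m\<in>UNIV. \<phi> (s$m) * c$m) = 0"
      using ann sum_matrix_vector_mult_transpose[of G "vmap \<phi> s" u]
      by (simp add: c_def vmap_def)
  qed
  finally show False
    using card by linarith
qed

text \<open>The square matrix with columns \<open>G \<phi>(s)\<close>, \<open>s \<in> S\<close>, has trivial left kernel, hence it is
  invertible.\<close>
lemma MRD_image_independent:
  fixes \<phi> :: "'k::field \<Rightarrow> 'a::field" and G :: "'a^'n^'kk" and S :: "('k^'n) set"
  assumes hom: "field_hom \<phi>" and mrd: "MRD \<phi> G" and rank: "rank G = CARD('kk)"
    and ind: "vec.independent S" and card: "card S = CARD('kk)"
  shows "inj_on (\<lambda>s. G *v vmap \<phi> s) S \<and> vec.independent ((\<lambda>s. G *v vmap \<phi> s) ` S)"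
proof -
  define h where "h = (\<lambda>s. G *v vmap \<phi> s)"
  have finS: "finite S"
    using ind by (rule vec.finiteI_independent)
  obtain b :: "'kk \<Rightarrow> 'k^'n" where b: "bij_betw b UNIV S"
    using finite_same_card_bij[of "UNIV :: 'kk set" S] finS card by auto
  define B :: "'a^'kk^'kk" where "B = (\<chi> i j. h (b j) $ i)"
  have "column j B = h (b j)" for j
    by (simp add: column_def B_def vec_eq_iff)
  then have "columns B = h ` S"
    using bij_betw_imp_surj_on[OF b] by (auto simp: columns_def)
  have "u = 0" if "transpose B *v u = 0" for u
  proof (rule MRD_annihilator_eq_0[OF hom mrd rank ind], use card in simp, intro ballI)
    fix s assume "s \<in> S"
    then obtain j where "s = b j"
      using bij_betw_imp_surj_on[OF b] by blast
    have "(transpose B *v u) $ j = (\<Sum>i\<in>UNIV. h (b j) $ i * u$i)"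
      by (simp add: matrix_vector_mult_def transpose_def B_def)
    then show "(\<Sum>i\<in>UNIV. (G *v vmap \<phi> s)$i * u$i) = 0"
      using that \<open>s = b j\<close> by (simp add: h_def)
  qed
  then have "\<exists>B'. B ** B' = mat 1"
    by (simp add: matrix_left_invertible_ker flip: left_invertible_transpose)
  then have span: "vec.span (h ` S) = UNIV"
    using \<open>columns B = h ` S\<close> matrix_right_invertible_span_columns by metis
  have "vec.dim (h ` S) = CARD('kk)"
    using vec.dim_span[of "h ` S"] by (simp add: span card_cart_basis)
  moreover have "card (h ` S) \<le> CARD('kk)"
    using card_image_le[OF finS] card by simp
  moreover have "vec.dim (h ` S) \<le> card (h ` S)"
    using finS by (intro vec.dim_le_card[OF vec.span_superset]) simp
  ultimately have card_hS: "card (h ` S) = card S" and "card (h ` S) \<le> vec.dim (h ` S)"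
    using card by simp_all
  then have "vec.independent (h ` S)"
    using finS by (intro vec.card_le_dim_spanning[OF subset_refl vec.span_superset]) simp_all
  moreover have "inj_on h S"
    using finS card_hS by (rule eq_card_imp_inj_on)
  ultimately show ?thesis
    unfolding h_def by blast
qed

lemma dim_GV_ge:
  fixes \<phi> :: "'k::field \<Rightarrow> 'a::field" and G :: "'a^'n^'kk" and U :: "('k^'n) set"
  assumes hom: "field_hom \<phi>" and mrd: "MRD \<phi> G" and rank: "rank G = CARD('kk)"
    and kn: "CARD('kk) \<le> CARD('n)" and dim: "vec.dim U \<le> CARD('kk)"
  shows "vec.dim U \<le> vec.dim (GV G \<phi> U)"
proof -
  define h where "h s = G *v vmap \<phi> s" for s
  obtain S where S: "S \<subseteq> U" "vec.independent S" "U \<subseteq> vec.span S" "card S = vec.dim U"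
    using vec.basis_exists[of U] by blast
  obtain B where B: "S \<subseteq> B" "vec.independent B" "finite B" "card B = CARD('n)"
    by (rule extend_to_basis_cart[OF S(2)])
  then have "CARD('kk) - card S \<le> card (B - S)"
    using B kn by (simp add: card_Diff_subset finite_subset)
  then obtain X where X: "X \<subseteq> B - S" "card X = CARD('kk) - card S"
    by (meson obtain_subset_with_card_n)
  have "vec.independent (S \<union> X)"
    using B(2) by (rule vec.independent_mono) (use B(1) X(1) in auto)
  moreover have "card (S \<union> X) = CARD('kk)"
    using X B(1,3) S(4) dim by (subst card_Un_disjoint) (auto intro: finite_subset)
  ultimately have inj: "inj_on h (S \<union> X)" and ind: "vec.independent (h ` (S \<union> X))"
    using MRD_image_independent[OF hom mrd rank] unfolding h_def by blast+
  have "inj_on h S"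
    using inj by (rule inj_on_subset) blast
  moreover have "vec.independent (h ` S)"
    using ind by (rule vec.independent_mono) blast
  moreover have "h ` S \<subseteq> GV G \<phi> U"
    using S(1) unfolding GV_def h_def by (auto intro: vec.span_base)
  ultimately show ?thesis
    using vec.independent_card_le_dim card_image S(4) by metis
qed

lemma dim_Inter_GV_ge:
  fixes \<phi> :: "'k::field \<Rightarrow> 'a::field" and G :: "'a^'n^'kk" and V :: "'b \<Rightarrow> ('k^'n) set"
  assumes hom: "field_hom \<phi>" and mrd: "MRD \<phi> G" and rank: "rank G = CARD('kk)"
    and kn: "CARD('kk) \<le> CARD('n)" and dim: "\<forall>i\<in>L. vec.dim (V i) \<le> CARD('kk)"
    and "finite L" and P: "partition_on L P"
  shows "(\<Sum>B\<in>P. int (vec.dim (\<Inter>j\<in>B. V j))) - (int (card P) - 1) * int CARD('kk)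
    \<le> int (vec.dim (\<Inter>i\<in>L. GV G \<phi> (V i)))"
proof -
  have "finite P"
    using \<open>finite L\<close> P by (rule finite_elements)
  have "vec.dim (\<Inter>j\<in>B. V j) \<le> vec.dim (GV G \<phi> (\<Inter>j\<in>B. V j))" if "B \<in> P" for B
  proof (rule dim_GV_ge[OF hom mrd rank kn])
    show "vec.dim (\<Inter>j\<in>B. V j) \<le> CARD('kk)"
      using P \<open>B \<in> P\<close> dim by (intro dim_Inter_le[of B L]) (auto simp: partition_on_def)
  qed
  then have "(\<Sum>B\<in>P. int (vec.dim (\<Inter>j\<in>B. V j))) - (int (card P) - 1) * int CARD('kk)
      \<le> (\<Sum>B\<in>P. int (vec.dim (GV G \<phi> (\<Inter>j\<in>B. V j)))) - (int (card P) - 1) * int CARD('kk)"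
    by (simp add: sum_mono)
  also have "\<dots> \<le> int (vec.dim (\<Inter>B\<in>P. GV G \<phi> (\<Inter>j\<in>B. V j)))"
    using \<open>finite P\<close> by (rule dim_Inter_ge) (simp add: GV_def vec.subspace_span)
  also have "\<dots> \<le> int (vec.dim (\<Inter>i\<in>L. GV G \<phi> (V i)))"
  proof (intro of_nat_mono vec.dim_subset INT_greatest)
    fix i assume "i \<in> L"
    then obtain B where "B \<in> P" "i \<in> B"
      using P by (auto simp: partition_on_def)
    then have "GV G \<phi> (\<Inter>j\<in>B. V j) \<subseteq> GV G \<phi> (V i)"
      unfolding GV_def by (intro vec.span_mono image_mono) blast
    then show "(\<Inter>B\<in>P. GV G \<phi> (\<Inter>j\<in>B. V j)) \<subseteq> GV G \<phi> (V i)"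
      using \<open>B \<in> P\<close> by blast
  qed
  finally show ?thesis .
qed

section \<open>Generic kernel patterns\<close>

lemma GV_row_vanishes:
  assumes "\<forall>v\<in>V. ((M ** G) *v vmap \<phi> v)$r = 0" "y \<in> GV G \<phi> V"
  shows "(M *v y)$r = 0"
  using assms(2) unfolding GV_def
proof (induction rule: vec.span_induct)
  case base
  show ?case
    by (auto intro!: vec.subspaceI simp: matrix_vector_right_distrib vector_scalar_commute)
next
  case (step x)
  then show ?case
    using assms(1) by (auto simp: matrix_vector_mul_assoc)
qed

lemma kernel_pattern_assignment:
  fixes V :: "'b \<Rightarrow> ('k::field^'n) set" and g :: "'kk \<Rightarrow> 'b option"
  assumes g: "\<forall>r i. g r = Some i \<longrightarrow> i \<in> L" and V: "\<forall>i\<in>L. vec.subspace (V i)"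
  shows "kernel_pattern (\<lambda>r. case g r of None \<Rightarrow> {0} | Some i \<Rightarrow> V i)"
  unfolding kernel_pattern_def
proof
  fix r
  show "vec.subspace (case g r of None \<Rightarrow> {0} | Some i \<Rightarrow> V i)"
    using g V by (cases "g r") (auto simp: vec.subspace_0)
qed

lemma kp_order_assignment:
  fixes V :: "'b \<Rightarrow> ('k::field^'n) set" and g :: "'kk \<Rightarrow> 'b option"
  assumes g: "\<forall>r i. g r = Some i \<longrightarrow> i \<in> L" and "finite L"
  shows "kp_order (\<lambda>r. case g r of None \<Rightarrow> {0} | Some i \<Rightarrow> V i) \<le> card L"
proof -
  have "range (\<lambda>r. case g r of None \<Rightarrow> {0} | Some i \<Rightarrow> V i) - {{0}} \<subseteq> V ` L"
    using g by (auto split: option.splits)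
  then have "kp_order (\<lambda>r. case g r of None \<Rightarrow> {0} | Some i \<Rightarrow> V i) \<le> card (V ` L)"
    unfolding kp_order_def using \<open>finite L\<close> by (intro card_mono) auto
  also have "\<dots> \<le> card L"
    using \<open>finite L\<close> by (rule card_image_le)
  finally show ?thesis .
qed

text \<open>Slots of \<open>\<Omega>\<close> assigned to blocks in \<open>S\<close> number at most \<open>a(S) \<le> codim \<Inter>\<^sub>j\<^sub>\<in>\<^sub>S V\<^sub>j\<close>;
  a single unassigned slot makes the intersection trivial.\<close>
lemma generic_kp_assignment:
  fixes V :: "'b \<Rightarrow> ('k::field^'n) set" and g :: "'kk::finite \<Rightarrow> 'b option"
  assumes g: "\<forall>r i. g r = Some i \<longrightarrow> i \<in> L" and g_card: "\<forall>i\<in>L. card {r. g r = Some i} = a i"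
    and a: "in_polymatroid L (\<lambda>S. CARD('kk) - vec.dim (\<Inter>j\<in>S. V j)) a"
    and dim: "\<forall>i\<in>L. vec.dim (V i) \<le> CARD('kk)" and "finite L"
  shows "generic_kp (\<lambda>r. case g r of None \<Rightarrow> {0} | Some i \<Rightarrow> V i)"
proof -
  define W where "W = (\<lambda>r. case g r of None \<Rightarrow> {0} | Some i \<Rightarrow> V i)"
  have "int (vec.dim (\<Inter>r\<in>\<Omega>. W r)) \<le> int CARD('kk) - int (card \<Omega>)" if "\<Omega> \<noteq> {}" for \<Omega>
  proof (cases "\<exists>r\<in>\<Omega>. g r = None")
    case True
    then have "(\<Inter>r\<in>\<Omega>. W r) \<subseteq> {0}"
      by (auto simp: W_def)
    then have "vec.dim (\<Inter>r\<in>\<Omega>. W r) = 0"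
      using vec.dim_subset[of "\<Inter>r\<in>\<Omega>. W r" "{0}"] by simp
    moreover have "card \<Omega> \<le> CARD('kk)"
      by (rule card_mono) auto
    ultimately show ?thesis
      by (simp del: vec.dim_eq_0)
  next
    case False
    define S where "S = the ` g ` \<Omega>"
    have S: "S \<subseteq> L" "S \<noteq> {}" "finite S"
      using False g that \<open>finite L\<close> by (auto simp: S_def intro: finite_subset)
    have Inter_eq: "(\<Inter>r\<in>\<Omega>. W r) = (\<Inter>j\<in>S. V j)"
      using False by (force simp: W_def S_def split: option.splits)
    have "vec.dim (\<Inter>j\<in>S. V j) \<le> CARD('kk)"
      using S(1,2) dim by (rule dim_Inter_le)
    moreover have "card \<Omega> \<le> (\<Sum>j\<in>S. card {r. g r = Some j})"
    proof -
      have "\<Omega> \<subseteq> (\<Union>j\<in>S. {r. g r = Some j})"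
        using False by (force simp: S_def)
      then have "card \<Omega> \<le> card (\<Union>j\<in>S. {r. g r = Some j})"
        by (rule card_mono[rotated]) simp
      also have "\<dots> = (\<Sum>j\<in>S. card {r. g r = Some j})"
        using \<open>finite S\<close> by (rule card_UN_disjoint) auto
      finally show ?thesis .
    qed
    moreover have "(\<Sum>j\<in>S. card {r. g r = Some j}) = sum a S"
      using g_card S(1) by (intro sum.cong) auto
    moreover have "sum a S \<le> CARD('kk) - vec.dim (\<Inter>j\<in>S. V j)"
      using a S(1,2) by (simp add: in_polymatroid_def)
    ultimately have "card \<Omega> + vec.dim (\<Inter>j\<in>S. V j) \<le> CARD('kk)"
      by linarith
    then show ?thesis
      unfolding Inter_eq by simp
  qed
  then show ?thesis
    unfolding generic_kp_def W_def by blast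
qed

text \<open>Row \<open>r\<close> of the attaining matrix annihilates \<open>GV(V\<^sub>i)\<close> whenever slot \<open>r\<close> is assigned to \<open>i\<close>,
  and \<open>a(L)\<close> slots are assigned.\<close>
lemma dim_Inter_GV_le_sum:
  fixes \<phi> :: "'k::field \<Rightarrow> 'a::field" and G :: "'a^'n^'kk" and V :: "'b \<Rightarrow> ('k^'n) set"
  assumes gkp: "GKP \<phi> G l" and "finite L" and "card L \<le> l"
    and V: "\<forall>i\<in>L. vec.subspace (V i) \<and> vec.dim (V i) \<le> CARD('kk)"
    and a: "in_polymatroid L (\<lambda>S. CARD('kk) - vec.dim (\<Inter>j\<in>S. V j)) a"
    and sum_a: "sum a L \<le> CARD('kk)"
  shows "vec.dim (\<Inter>i\<in>L. GV G \<phi> (V i)) \<le> CARD('kk) - sum a L"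
proof -
  obtain g :: "'kk \<Rightarrow> 'b option" where g: "\<forall>r i. g r = Some i \<longrightarrow> i \<in> L"
    and g_card: "\<forall>i\<in>L. card {r. g r = Some i} = a i" and used: "card {r. g r \<noteq> None} = sum a L"
    by (metis ex_slot_assignment[OF \<open>finite L\<close> sum_a])
  define W where "W = (\<lambda>r. case g r of None \<Rightarrow> {0} | Some i \<Rightarrow> V i)"
  have "generic_kp W"
    unfolding W_def using V by (intro generic_kp_assignment[OF g g_card a _ \<open>finite L\<close>]) auto
  moreover have "kernel_pattern W"
    unfolding W_def using V by (intro kernel_pattern_assignment[OF g]) auto
  moreover have "kp_order W \<le> l"
    using kp_order_assignment[OF g \<open>finite L\<close>, of V] \<open>card L \<le> l\<close> unfolding W_def by linarith
  ultimately obtain M :: "'a^'kk^'kk" where M: "invertible M"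
    and M_W: "\<forall>r. \<forall>v\<in>W r. ((M ** G) *v vmap \<phi> v)$r = 0"
    using gkp unfolding GKP_def attains_def by blast
  have "vec.dim (\<Inter>i\<in>L. GV G \<phi> (V i)) \<le> CARD('kk) - card {r. g r \<noteq> None}"
  proof (rule dim_le_if_rows_vanish[OF M], intro ballI)
    fix y r assume "y \<in> (\<Inter>i\<in>L. GV G \<phi> (V i))" "r \<in> {r. g r \<noteq> None}"
    then obtain i where "g r = Some i" "y \<in> GV G \<phi> (V i)"
      using g by auto
    then show "(M *v y)$r = 0"
      using M_W by (intro GV_row_vanishes[of "V i"]) (auto simp: W_def)
  qed
  then show ?thesis
    unfolding used .
qed

lemma dim_Inter_GV_le:
  fixes \<phi> :: "'k::field \<Rightarrow> 'a::field" and G :: "'a^'n^'kk" and V :: "'b \<Rightarrow> ('k^'n) set"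
  assumes gkp: "GKP \<phi> G l" and "finite L" and "card L \<le> l"
    and V: "\<forall>i\<in>L. vec.subspace (V i) \<and> vec.dim (V i) \<le> CARD('kk)"
  shows "\<exists>P. partition_on L P \<and> int (vec.dim (\<Inter>i\<in>L. GV G \<phi> (V i)))
    \<le> (\<Sum>B\<in>P. int (vec.dim (\<Inter>j\<in>B. V j))) - (int (card P) - 1) * int CARD('kk)"
proof -
  define f where "f = (\<lambda>S. CARD('kk) - vec.dim (\<Inter>j\<in>S. V j))"
  have dim_le: "vec.dim (\<Inter>j\<in>S. V j) \<le> CARD('kk)" if "S \<subseteq> L" "S \<noteq> {}" for S
    using that V by (intro dim_Inter_le) auto
  have "f (S \<union> T) + f (S \<inter> T) \<le> f S + f T" if "S \<subseteq> L" "T \<subseteq> L" "S \<inter> T \<noteq> {}" for S T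
    using dim_Inter_supermodular[of S T V] dim_le[of "S \<union> T"] dim_le[of "S \<inter> T"] that V
    unfolding f_def by fastforce
  then obtain a P where a: "in_polymatroid L f a" and P: "partition_on L P"
    and sum_a: "sum a L = (\<Sum>B\<in>P. f B)"
    using in_polymatroid_tight_partition[OF \<open>finite L\<close>] by metis
  have "sum a L \<le> CARD('kk)"
    using a by (cases "L = {}") (auto simp: in_polymatroid_def f_def)
  moreover have "in_polymatroid L (\<lambda>S. CARD('kk) - vec.dim (\<Inter>j\<in>S. V j)) a"
    using a by (simp add: f_def)
  ultimately have "vec.dim (\<Inter>i\<in>L. GV G \<phi> (V i)) \<le> CARD('kk) - sum a L"
    using dim_Inter_GV_le_sum[OF gkp \<open>finite L\<close> \<open>card L \<le> l\<close> V] by blast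
  then have "int (vec.dim (\<Inter>i\<in>L. GV G \<phi> (V i))) \<le> int (CARD('kk) - sum a L)"
    by (rule of_nat_mono)
  also have "\<dots> = int CARD('kk) - int (sum a L)"
    using \<open>sum a L \<le> CARD('kk)\<close> by (rule of_nat_diff)
  also have "int (sum a L) = (\<Sum>B\<in>P. int CARD('kk) - int (vec.dim (\<Inter>j\<in>B. V j)))"
    unfolding sum_a of_nat_sum
  proof (rule sum.cong)
    fix B assume "B \<in> P"
    then have "B \<subseteq> L" "B \<noteq> {}"
      using P by (auto simp: partition_on_def)
    then show "int (f B) = int CARD('kk) - int (vec.dim (\<Inter>j\<in>B. V j))"
      unfolding f_def by (simp add: dim_le of_nat_diff)
  qed simp
  also have "\<dots> = int (card P) * int CARD('kk) - (\<Sum>B\<in>P. int (vec.dim (\<Inter>j\<in>B. V j)))"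
    by (simp add: sum_subtractf)
  finally show ?thesis
    using P by (intro exI[of _ P]) (simp add: algebra_simps)
qed

theorem mainTheorem15:
  fixes \<phi> :: "'k::{finite,field} \<Rightarrow> 'a::field"
    and G :: "'a^'n^'kk"
    and l :: nat
    and V :: "nat \<Rightarrow> ('k^'n) set"
  assumes "field_hom \<phi>"
    and "CARD('kk) \<le> CARD('n)"
    and "l \<ge> 1"
    and "rank G = CARD('kk)"
    and "GKP \<phi> G l"
    and "\<forall>i\<in>{1..l}. vec.subspace (V i) \<and> vec.dim (V i) \<le> CARD('kk)"
  shows "int (vec.dim (\<Inter>i\<in>{1..l}. GV G \<phi> (V i))) =
    Max {(\<Sum>B\<in>P. int (vec.dim (\<Inter>j\<in>B. V j))) - (int (card P) - 1) * int CARD('kk)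
         | P. partition_on {1..l} P}"
proof -
  define bound where
    "bound P = (\<Sum>B\<in>P. int (vec.dim (\<Inter>j\<in>B. V j))) - (int (card P) - 1) * int CARD('kk)" for P
  have mrd: "MRD \<phi> G"
    using assms(5) by (simp add: GKP_def)
  have dim: "\<forall>i\<in>{1..l}. vec.dim (V i) \<le> CARD('kk)"
    using assms(6) by blast
  have lower: "bound P \<le> int (vec.dim (\<Inter>i\<in>{1..l}. GV G \<phi> (V i)))" if "partition_on {1..l} P" for P
    unfolding bound_def using dim_Inter_GV_ge[OF assms(1) mrd assms(4,2) dim _ that] by simp
  obtain P where "partition_on {1..l} P" "int (vec.dim (\<Inter>i\<in>{1..l}. GV G \<phi> (V i))) \<le> bound P"
    unfolding bound_def using dim_Inter_GV_le[OF assms(5) _ _ assms(6)] by auto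
  then have "Max (bound ` {P. partition_on {1..l} P}) = int (vec.dim (\<Inter>i\<in>{1..l}. GV G \<phi> (V i)))"
    using lower finitely_many_partition_on[of "{1..l}"]
    by (intro Max_eqI) (auto intro!: antisym)
  then show ?thesis
    unfolding bound_def by (simp add: setcompr_eq_image)
qed

end
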